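(* Let $v_1,\ldots,v_n$ be $n\geq 3$ distinct points in the $d$-dimensional unit sphere $S^d\subset\mathbb{R}^{d+1}$. Then there exists a Möbius transformation $T$ of $S^d$ such that $$\sum_{j=1}^n T v_j = 0 \in \mathbb{R}^{d+1}.$$ If $\widetilde T$ is another Möbius transformation of $S^d$ with $\sum_{j=1}^n \widetilde T v_j=0$, then $\widetilde T = R T$, where $R$ is an isometry of $S^d$.
   Context: Here $d\ge 1$ is an integer and $S^d=\{y\in\mathbb{R}^{d+1} : |y|=1\}$. The sphere $S^d$ is identified with the quadric $\{-x_0^2+x_1^2+\cdots+x_{d+1}^2=0\}$ in real projective space $\mathbb{R}\mathrm{P}^{d+1}$ via $y\mapsto [1:y_1:\cdots:y_{d+1}]$. The Möbius group of $S^d$ is the group $O(d+1,1)/\{\pm1\}$ of projective transformations of $\mathbb{R}\mathrm{P}^{d+1}$ that map this quadric to itself, acting on $S^d$ (so orientation-reversing transformations are included); here $O(d+1,1)\subset GL(d+2,\mathbb{R})$ is the group of linear maps preserving the quadratic form $-x_0^2+x_1^2+\cdots+x_{d+1}^2$, acting linearly on homogeneous coordinates. An isometry of $S^d$ is the restriction to $S^d$ of an orthogonal transformation of $\mathbb{R}^{d+1}$. *)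

theory Defs
  imports "HOL-Analysis.Analysis"
begin

text \<open>
  A type \<open>'n\<close> with \<open>CARD('n) = d + 1\<close> indexes the coordinates of $R^{d+1}$, so that
  \<open>sphere 0 1 :: (real ^ 'n) set\<close> is $S^d$. The homogeneous coordinates
  $(x_0, x_1, \ldots, x_{d+1})$ live in \<open>real \<times> (real ^ 'n)\<close>, the first component being $x_0$.
\<close>

definition lorentz_form :: "real \<times> (real ^ 'n) \<Rightarrow> real" where
  "lorentz_form x = - (fst x)\<^sup>2 + (\<Sum>i\<in>UNIV. (snd x $ i)\<^sup>2)"

definition lorentz_group :: "(real \<times> (real ^ 'n) \<Rightarrow> real \<times> (real ^ 'n)) set" where
  "lorentz_group = {A. linear A \<and> bij A \<and> (\<forall>x. lorentz_form (A x) = lorentz_form x)}"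

text \<open>
  A point of projective space is a line through the origin, and the projective transformation
  given by a linear bijection \<open>A\<close> sends the line \<open>L\<close> to \<open>A ` L\<close>.
\<close>

definition proj_pt :: "real \<times> (real ^ 'n) \<Rightarrow> (real \<times> (real ^ 'n)) set" where
  "proj_pt x = span {x}"

definition sphere_to_proj :: "real ^ 'n \<Rightarrow> (real \<times> (real ^ 'n)) set" where
  "sphere_to_proj y = proj_pt (1, y)"

text \<open>
  The predicate only constrains \<open>T\<close> on the unit sphere; values elsewhere are irrelevant.
\<close>

definition moebius :: "(real ^ 'n \<Rightarrow> real ^ 'n) \<Rightarrow> bool" where
  "moebius T \<longleftrightarrow>
    (\<exists>A\<in>lorentz_group. \<forall>y\<in>sphere 0 1.
       T y \<in> sphere 0 1 \<and> sphere_to_proj (T y) = A ` sphere_to_proj y)"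

end

(* In homogeneous coordinates, T given by A balances the v j iff the point p = A^{-1} (1, 0) of
   hyperbolic space satisfies: sum_j (1, v j) / L((1, v j), p) is parallel to p, where L is the
   Lorentz product. This is the critical point equation of the sum of distances from p to horospheres
   centred at the v j, a strictly convex function that tends to infinity at the boundary as n > 2. A
   minimum gives T. For uniqueness one may take the v j to be balanced already, so that (1, 0) is
   critical; strict convexity forces p = (1, 0), and then A (up to sign) is an orthogonal map of the
   last d + 1 coordinates. *)

theory Submission
  imports Defs
begin

section \<open>The Lorentz product and its invariance\<close>

definition lorentz_inner :: "real \<times> (real ^ 'n) \<Rightarrow> real \<times> (real ^ 'n) \<Rightarrow> real" where
  "lorentz_inner x y = snd x \<bullet> snd y - fst x * fst y"

lemma lorentz_form_eq_inner: "lorentz_form x = lorentz_inner x x"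
  by (simp add: lorentz_form_def lorentz_inner_def inner_vec_def power2_eq_square)

lemma lorentz_inner_polarization:
  "2 * lorentz_inner x y = lorentz_form (x + y) - lorentz_form x - lorentz_form y"
  by (simp add: lorentz_form_eq_inner lorentz_inner_def inner_commute algebra_simps)

text \<open>Membership in \<open>lorentz_group\<close> speaks of the quadratic form; polarization
  carries the invariance over to the product.\<close>

lemma lorentz_group_inner:
  assumes "A \<in> lorentz_group"
  shows "lorentz_inner (A x) (A y) = lorentz_inner x y"
proof -
  have A: "linear A" "\<And>x. lorentz_form (A x) = lorentz_form x"
    using assms by (auto simp: lorentz_group_def)
  have "2 * lorentz_inner (A x) (A y) = 2 * lorentz_inner x y"
    unfolding lorentz_inner_polarization linear_add[OF A(1), symmetric] A(2) ..
  then show ?thesis by simp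
qed

lemma lorentz_group_compose_inv:
  assumes "A \<in> lorentz_group" and "B \<in> lorentz_group"
  shows "B \<circ> inv A \<in> lorentz_group"
proof -
  have A: "linear A" "bij A" "\<And>x. lorentz_form (A x) = lorentz_form x"
    and B: "linear B" "bij B" "\<And>x. lorentz_form (B x) = lorentz_form x"
    using assms by (auto simp: lorentz_group_def)
  have inv: "A (inv A x) = x" for x
    using A(2) by (simp add: bij_is_surj surj_f_inv_f)
  have "linear (inv A)"
    using A(1,2) by (simp add: bij_is_inj inj_linear_imp_inv_linear)
  moreover have "lorentz_form (inv A x) = lorentz_form x" for x
    using A(3)[of "inv A x"] inv by simp
  ultimately show ?thesis
    using A B by (simp add: lorentz_group_def linear_compose bij_comp bij_imp_bij_inv)
qed

text \<open>\<open>A\<close> and \<open>- A\<close> act alike on lines, so the sign of a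
  representing Lorentz map can be chosen freely; the uniqueness proof uses this to make an
  \<open>x_0\<close> coordinate positive.\<close>

lemma lorentz_group_uminus:
  fixes A :: "real \<times> (real ^ 'n) \<Rightarrow> real \<times> (real ^ 'n)"
  assumes "A \<in> lorentz_group"
  shows "(\<lambda>x. - A x) \<in> lorentz_group"
proof -
  have A: "linear A" "bij A" "\<And>x. lorentz_form (A x) = lorentz_form x"
    using assms by (auto simp: lorentz_group_def)
  have "bij (uminus \<circ> A)"
    using A(2) by (intro bij_comp bij_uminus)
  then have "bij (\<lambda>x. - A x)"
    by (simp add: o_def)
  moreover have "lorentz_form (- x) = lorentz_form x" for x :: "real \<times> (real ^ 'n)"
    by (simp add: lorentz_form_def)
  ultimately show ?thesis
    using A by (simp add: lorentz_group_def linear_compose_neg del: split_paired_All)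
qed

section \<open>Moebius transformations in homogeneous coordinates, and a Lorentz map centring a
  given point\<close>

text \<open>Generators of the same line are proportional. The scalar may be negative, since
  \<open>A\<close> may interchange the two halves of the light cone.\<close>

lemma moebius_homogeneous:
  assumes lin: "linear A" and y: "sphere_to_proj z = A ` sphere_to_proj y"
  obtains c where "c \<noteq> 0" and "A (1, y) = (c, c *\<^sub>R z)"
proof -
  have eq: "span {(1, z)} = span {A (1, y)}"
    using y lin by (simp add: sphere_to_proj_def proj_pt_def linear_span_image[symmetric])
  have "A (1, y) \<in> span {(1, z)}"
    unfolding eq by (simp add: span_base)
  then obtain c where c: "A (1, y) = c *\<^sub>R (1, z)"
    by (auto simp: span_singleton)
  have "(1, z) \<in> span {A (1, y)}"
    unfolding eq[symmetric] by (simp add: span_base)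
  with c have "c \<noteq> 0"
    by (auto simp: span_singleton zero_prod_def)
  with c show ?thesis
    by (intro that) auto
qed

lemma moebius_obtain:
  assumes "moebius T"
  obtains A c where "A \<in> lorentz_group"
    and "\<And>y. y \<in> sphere 0 1 \<Longrightarrow> T y \<in> sphere 0 1"
    and "\<And>y. y \<in> sphere 0 1 \<Longrightarrow> c y \<noteq> 0"
    and "\<And>y. y \<in> sphere 0 1 \<Longrightarrow> A (1, y) = (c y, c y *\<^sub>R T y)"
proof -
  from assms obtain A where A: "A \<in> lorentz_group"
    and T: "\<And>y. y \<in> sphere 0 1 \<Longrightarrow> T y \<in> sphere 0 1"
    and P: "\<And>y. y \<in> sphere 0 1 \<Longrightarrow> sphere_to_proj (T y) = A ` sphere_to_proj y"
    unfolding moebius_def by blast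
  have lin: "linear A"
    using A by (simp add: lorentz_group_def)
  have "\<forall>y\<in>sphere 0 1. \<exists>c. c \<noteq> 0 \<and> A (1, y) = (c, c *\<^sub>R T y)"
    using moebius_homogeneous[OF lin P] by metis
  then obtain c where "\<forall>y\<in>sphere 0 1. c y \<noteq> 0 \<and> A (1, y) = (c y, c y *\<^sub>R T y)"
    by metis
  with A T show ?thesis
    by (intro that[of A c]) auto
qed

text \<open>The vector \<open>(1, y)\<close> is lightlike, hence so is its image; dividing a
  lightlike vector by its nonzero \<open>x_0\<close> coordinate leaves a unit vector in the
  remaining coordinates.\<close>

lemma moebiusI:
  fixes A :: "real \<times> (real ^ 'n) \<Rightarrow> real \<times> (real ^ 'n)"
  assumes A: "A \<in> lorentz_group"
    and pos: "\<And>y. y \<in> sphere 0 1 \<Longrightarrow> fst (A (1, y)) \<noteq> 0"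
  shows "moebius (\<lambda>y. snd (A (1, y)) /\<^sub>R fst (A (1, y)))"
  unfolding moebius_def
proof (intro bexI[OF _ A] ballI conjI)
  fix y :: "real ^ 'n"
  assume y: "y \<in> sphere 0 1"
  let ?t = "fst (A (1, y))" and ?s = "snd (A (1, y))"
  have t: "?t \<noteq> 0"
    using pos y by blast
  have "lorentz_inner (A (1, y)) (A (1, y)) = 0"
    using y by (simp add: lorentz_group_inner[OF A]) (simp add: lorentz_inner_def dot_square_norm)
  then have "(norm ?s)\<^sup>2 = ?t\<^sup>2"
    by (simp add: lorentz_inner_def dot_square_norm power2_eq_square)
  then have "norm ?s = \<bar>?t\<bar>"
    by (metis real_sqrt_abs abs_norm_cancel)
  then show "?s /\<^sub>R ?t \<in> sphere 0 1"
    using t by simp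
  have "(1, ?s /\<^sub>R ?t) = inverse ?t *\<^sub>R A (1, y)"
    using t by (simp add: prod_eq_iff)
  then have "span {(1, ?s /\<^sub>R ?t)} = span {A (1, y)}"
    using t by (simp add: span_image_scale[of "{A (1, y)}" "\<lambda>_. inverse ?t", simplified])
  also have "\<dots> = A ` span {(1, y)}"
    using A by (simp add: lorentz_group_def linear_span_image[symmetric])
  finally show "sphere_to_proj (?s /\<^sub>R ?t) = A ` sphere_to_proj y"
    by (simp add: sphere_to_proj_def proj_pt_def)
qed

text \<open>The map below is minus the Lorentz reflection in the timelike vector \<open>p + (1, 0)\<close>.
  It exchanges \<open>p\<close> and \<open>(1, 0)\<close>, and unlike a boost it needs no case distinction at
  \<open>p = (1, 0)\<close>.\<close>

lemma lorentz_group_exchange: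
  fixes p :: "real \<times> (real ^ 'n)"
  assumes p: "lorentz_form p = -1" and p0: "fst p > 0"
  obtains A where "A \<in> lorentz_group" and "A p = (1, 0)"
    and "\<And>u. fst (A u) = - lorentz_inner u p"
proof -
  define w where "w = p + (1, 0)"
  \<comment> \<open>The reflection subtracts
    \<open>2 * lorentz_inner u w / lorentz_inner w w\<close> times \<open>w\<close> from
    \<open>u\<close>. The denominator is \<open>- 2 * (1 + fst p)\<close>, which gives this
    coefficient after the change of sign.\<close>
  define A where "A u = - u - (lorentz_inner u w / (1 + fst p)) *\<^sub>R w" for u
  have pp: "lorentz_inner p p = -1"
    using p by (simp add: lorentz_form_eq_inner)
  have add: "lorentz_inner (x + y) z = lorentz_inner x z + lorentz_inner y z"
    "lorentz_inner (x - y) z = lorentz_inner x z - lorentz_inner y z"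
    "lorentz_inner (- x) z = - lorentz_inner x z"
    "lorentz_inner (r *\<^sub>R x) z = r * lorentz_inner x z"
    "lorentz_inner x (r *\<^sub>R y) = r * lorentz_inner x y"
    "lorentz_inner x (y + z) = lorentz_inner x y + lorentz_inner x z"
    "lorentz_inner x (y - z) = lorentz_inner x y - lorentz_inner x z"
    "lorentz_inner x (- y) = - lorentz_inner x y"
    for x y z :: "real \<times> (real ^ 'n)" and r
    by (simp_all add: lorentz_inner_def algebra_simps)
  have comm: "lorentz_inner x y = lorentz_inner y x" for x y :: "real \<times> (real ^ 'n)"
    by (simp add: lorentz_inner_def inner_commute)
  have e: "lorentz_inner u (1, 0) = - fst u" for u :: "real \<times> (real ^ 'n)"
    by (simp add: lorentz_inner_def)
  have ww: "lorentz_inner w w = - 2 * (1 + fst p)"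
    using e[of p] e[of "(1,0)"] comm[of "(1,0)" p] by (simp add: w_def add pp)
  have Aw: "lorentz_inner (A u) w = lorentz_inner u w" for u
    using p0 by (simp add: A_def add ww field_simps)
  have lin: "linear A"
    by (rule linearI) (simp_all add: A_def add algebra_simps add_divide_distrib)
  \<comment> \<open>As \<open>u\<close> and \<open>A u\<close> have the same product with
    \<open>w\<close>, the multiples of \<open>w\<close> in \<open>A (A u)\<close> cancel.\<close>
  have invol: "A (A u) = u" for u
    using Aw[of u] by (simp add: A_def)
  have bij: "bij A"
    using invol by (metis bij_def injI surjI)
  have form: "lorentz_form (A u) = lorentz_form u" for u
  proof -
    have "lorentz_inner (A u) (A u) =
        - lorentz_inner u (A u) - (lorentz_inner u w / (1 + fst p)) * lorentz_inner w (A u)"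
      by (subst (1) A_def) (simp add: add)
    also have "lorentz_inner w (A u) = lorentz_inner u w"
      using Aw comm by metis
    also have "lorentz_inner u (A u) = - lorentz_inner u u
        - (lorentz_inner u w / (1 + fst p)) * lorentz_inner u w"
      by (simp add: A_def add)
    finally show ?thesis
      by (simp add: lorentz_form_eq_inner)
  qed
  have "lorentz_inner p w = - (1 + fst p)"
    by (simp add: w_def add pp e)
  then have "lorentz_inner p w / (1 + fst p) = -1"
    using p0 by (simp add: field_simps)
  then have "A p = (1, 0)"
    by (simp add: A_def) (simp add: w_def)
  moreover have "fst (A u) = - lorentz_inner u p" for u
  proof -
    have "fst w = 1 + fst p"
      by (simp add: w_def)
    then have "fst (A u) = - fst u - lorentz_inner u w"
      using p0 by (simp add: A_def)
    also have "\<dots> = - lorentz_inner u p"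
      by (simp add: w_def add e)
    finally show ?thesis .
  qed
  ultimately show ?thesis
    using lin bij form by (intro that[of A]) (auto simp: lorentz_group_def)
qed

section \<open>Minimizing the sum of horosphere distances in the ball model\<close>

text \<open>The first bound is the expansion of the squared distance from \<open>x\<close> to
  \<open>u\<close>. It keeps a single logarithm from falling much below
  \<open>ln (1 - x \<bullet> x)\<close>.\<close>

lemma one_minus_inner_pos:
  fixes x u :: "'a::real_inner"
  assumes "norm x < 1" and "norm u = 1"
  shows "(1 - x \<bullet> x) / 2 \<le> 1 - x \<bullet> u" and "0 < 1 - x \<bullet> u" and "0 < 1 - x \<bullet> x"
proof -
  have uu: "u \<bullet> u = 1"
    using assms by (simp add: dot_square_norm)
  have "0 \<le> (x - u) \<bullet> (x - u)"
    by simp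
  then show *: "(1 - x \<bullet> x) / 2 \<le> 1 - x \<bullet> u"
    using uu by (simp add: inner_diff_left inner_diff_right inner_commute field_simps)
  have "(norm x)\<^sup>2 < 1"
    using assms by (simp add: power_less_one_iff abs_square_less_1)
  then show "0 < 1 - x \<bullet> x"
    by (simp add: dot_square_norm)
  from less_le_trans[OF half_gt_zero[OF this] *] show "0 < 1 - x \<bullet> u" .
qed

text \<open>A small value of \<open>1 - x \<bullet> v j\<close> means that \<open>x\<close> is close
  to \<open>v j\<close>, and by the triangle inequality \<open>x\<close> cannot be close to two
  points that are far apart.\<close>

lemma inner_separation:
  fixes v :: "'i \<Rightarrow> 'a::real_inner"
  assumes "finite J" and "inj_on v J" and unit: "\<And>j. j \<in> J \<Longrightarrow> norm (v j) = 1"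
  obtains e :: real where "0 < e" and "e \<le> 1"
    and "\<And>x j k. \<lbrakk>norm x < 1; j \<in> J; k \<in> J; j \<noteq> k; 1 - x \<bullet> v j < e\<rbrakk> \<Longrightarrow> e \<le> 1 - x \<bullet> v k"
proof -
  define D where "D = (\<lambda>(j,k). dist (v j) (v k)) ` {(j,k) \<in> J \<times> J. j \<noteq> k}"
  have "finite {(j,k) \<in> J \<times> J. j \<noteq> k}"
    using assms(1) by (auto intro: finite_subset[of _ "J \<times> J"])
  then have fin: "finite (insert 1 D)"
    by (simp add: D_def)
  \<comment> \<open>Inserting 1 keeps the set nonempty for every \<open>J\<close> and makes the
    resulting threshold at most 1.\<close>
  define d where "d = Min (insert 1 D)"
  have dpos: "d > 0"
    unfolding d_def using fin assms(2) by (subst Min_gr_iff) (auto simp: D_def inj_on_def)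
  have dle: "d \<le> 1"
    unfolding d_def using fin by simp
  have dd: "d \<le> dist (v j) (v k)" if "j \<in> J" "k \<in> J" "j \<noteq> k" for j k
    unfolding d_def using that fin by (intro Min_le) (auto simp: D_def)
  \<comment> \<open>The squared distance is less than \<open>2 * (1 - x \<bullet> v j)\<close>
    inside the ball; the threshold is chosen to make this bound
    \<open>(d / 2)\<^sup>2\<close>.\<close>
  have near: "dist x (v j) < d / 2" if "norm x < 1" "j \<in> J" "1 - x \<bullet> v j < d\<^sup>2 / 8" for x j
  proof -
    have vv: "v j \<bullet> v j = 1"
      using unit that(2) by (simp add: dot_square_norm)
    have "(dist x (v j))\<^sup>2 = (x - v j) \<bullet> (x - v j)"
      by (simp add: dist_norm dot_square_norm)
    also have "\<dots> = x \<bullet> x - 1 + 2 * (1 - x \<bullet> v j)"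
      using vv by (simp add: inner_diff_left inner_diff_right inner_commute)
    also have "\<dots> < (d / 2)\<^sup>2"
      using one_minus_inner_pos(3)[of x "v j"] that unit by (simp add: power_divide)
    finally show ?thesis
      by (rule power_less_imp_less_base) (use dpos in simp)
  qed
  show ?thesis
  proof (rule that[of "d\<^sup>2 / 8"])
    show "0 < d\<^sup>2 / 8"
      using dpos by simp
    have "d\<^sup>2 \<le> 1"
      using dpos dle by (simp add: power_le_one)
    then show "d\<^sup>2 / 8 \<le> 1"
      by simp
    fix x j k
    assume *: "norm x < 1" "j \<in> J" "k \<in> J" "j \<noteq> k" "1 - x \<bullet> v j < d\<^sup>2 / 8"
    show "d\<^sup>2 / 8 \<le> 1 - x \<bullet> v k"
    proof (rule ccontr)
      assume "\<not> ?thesis"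
      then have "dist x (v k) < d / 2"
        using near * by simp
      moreover have "dist x (v j) < d / 2"
        using near * by simp
      ultimately have "dist (v j) (v k) < d"
        by (metis dist_triangle_half_r)
      with dd * show False
        by fastforce
    qed
  qed
qed

text \<open>In the ball model, \<open>\<Sum>j. ln (1 - x \<bullet> v j) - (n/2) * ln (1 - x \<bullet> x)\<close> is the
  sum of the hyperbolic distances from \<open>x\<close> to horospheres centred at the \<open>v j\<close>. At most one
  of the first \<open>n\<close> terms can be very negative, and then no less than \<open>ln ((1 - x \<bullet> x) / 2)\<close>;
  since \<open>n > 2\<close>, the last term dominates near the boundary.\<close>

lemma horosphere_distance_sum_minimum:
  fixes v :: "'i \<Rightarrow> 'a::euclidean_space"
  assumes fin: "finite J" and inj: "inj_on v J" and card: "card J \<ge> 3"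
    and unit: "\<And>j. j \<in> J \<Longrightarrow> norm (v j) = 1"
  defines "f \<equiv> \<lambda>x. (\<Sum>j\<in>J. ln (1 - x \<bullet> v j)) - real (card J) / 2 * ln (1 - x \<bullet> x)"
  obtains x where "norm x < 1" and "\<And>y. norm y < 1 \<Longrightarrow> f x \<le> f y"
proof -
  obtain e :: real where e: "0 < e" "e \<le> 1"
    and sep: "\<And>x j k. \<lbrakk>norm x < 1; j \<in> J; k \<in> J; j \<noteq> k; 1 - x \<bullet> v j < e\<rbrakk> \<Longrightarrow> e \<le> 1 - x \<bullet> v k"
    using inner_separation[OF fin inj unit] by metis
  define n where "n = real (card J)"
  have n: "n \<ge> 3"
    using card by (simp add: n_def)
  \<comment> \<open>All but one of the logarithms are at least \<open>ln e\<close>; the remaining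
    one is at least \<open>ln (1 - x \<bullet> x) - ln 2\<close>. The constants add up to
    \<open>K\<close>, while \<open>ln (1 - x \<bullet> x)\<close> lowers the factor
    \<open>n / 2\<close> to \<open>(n - 2) / 2\<close>.\<close>
  define K where "K = (n - 1) * ln e - ln 2"
  have "(n - 1) * ln e \<le> 0"
    using n e by (intro mult_nonneg_nonpos) auto
  then have K: "K \<le> 0"
    using ln_gt_zero[of "2::real"] unfolding K_def by linarith
  have low: "K - (n - 2) / 2 * ln (1 - x \<bullet> x) \<le> f x" if x: "norm x < 1" for x
  proof -
    have "\<exists>k\<in>J. \<forall>j\<in>J - {k}. e \<le> 1 - x \<bullet> v j"
    proof (cases "\<exists>k\<in>J. 1 - x \<bullet> v k < e")
      case True
      then show ?thesis
        using sep x by blast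
    next
      case False
      moreover have "J \<noteq> {}"
        using card by auto
      ultimately show ?thesis
        by (metis Diff_iff all_not_in_conv not_less)
    qed
    then obtain k where k: "k \<in> J" and far: "\<And>j. j \<in> J - {k} \<Longrightarrow> e \<le> 1 - x \<bullet> v j"
      by blast
    have pos: "0 < 1 - x \<bullet> x"
      using one_minus_inner_pos(3)[OF x unit[OF k]] .
    have "(n - 1) * ln e = (\<Sum>j\<in>J - {k}. ln e)"
      using fin k card by (simp add: n_def)
    also have "\<dots> \<le> (\<Sum>j\<in>J - {k}. ln (1 - x \<bullet> v j))"
      using far e by (intro sum_mono) (simp add: ln_mono)
    finally have 1: "(n - 1) * ln e \<le> (\<Sum>j\<in>J - {k}. ln (1 - x \<bullet> v j))" .
    have "ln ((1 - x \<bullet> x) / 2) \<le> ln (1 - x \<bullet> v k)"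
      using one_minus_inner_pos[OF x unit[OF k]] by (intro ln_mono) auto
    then have 2: "ln (1 - x \<bullet> x) - ln 2 \<le> ln (1 - x \<bullet> v k)"
      using pos by (simp add: ln_div)
    have "(\<Sum>j\<in>J. ln (1 - x \<bullet> v j)) = ln (1 - x \<bullet> v k) + (\<Sum>j\<in>J - {k}. ln (1 - x \<bullet> v j))"
      using fin k by (rule sum.remove)
    with 1 2 show ?thesis
      by (simp add: f_def K_def n_def[symmetric] field_simps)
  qed
  \<comment> \<open>In the ball but outside \<open>S\<close>,
    \<open>ln (1 - x \<bullet> x) < 2 * K\<close>. With \<open>(n - 2) / 2 \<ge> 1 / 2\<close> and
    \<open>K \<le> 0\<close> the lower bound is then nonnegative, so \<open>f\<close> is at least
    \<open>f 0 = 0\<close> there. As \<open>0\<close> lies in \<open>S\<close>, a minimum over the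
    compact set \<open>S\<close> is one over the ball.\<close>
  define S where "S = {x :: 'a. exp (2 * K) \<le> 1 - x \<bullet> x}"
  have norm1: "x \<bullet> x < 1 \<longleftrightarrow> norm x < 1" for x :: 'a
    by (simp add: dot_square_norm abs_square_less_1)
  have Sball: "norm x < 1" if "x \<in> S" for x
  proof -
    have "0 < 1 - x \<bullet> x"
      using that by (intro less_le_trans[OF exp_gt_zero[of "2 * K"]]) (simp add: S_def)
    then show ?thesis
      by (simp add: norm1)
  qed
  have "closed S"
    unfolding S_def by (intro closed_Collect_le continuous_intros)
  moreover have "bounded S"
    using Sball by (intro boundedI[of _ 1]) (simp add: less_imp_le)
  ultimately have "compact S"
    by (simp add: compact_eq_bounded_closed)
  moreover have 0: "0 \<in> S"
    using K by (simp add: S_def)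
  moreover have "continuous_on S f"
    unfolding f_def
    using one_minus_inner_pos(2)[OF Sball unit] Sball norm1
    by (intro continuous_intros) (force simp: less_le)+
  ultimately obtain x where x: "x \<in> S" and min: "\<And>y. y \<in> S \<Longrightarrow> f x \<le> f y"
    using continuous_attains_inf[of S f] by blast
  show ?thesis
  proof (rule that[OF Sball[OF x]])
    fix y :: 'a
    assume y: "norm y < 1"
    show "f x \<le> f y"
    proof (cases "y \<in> S")
      case False
      have ypos: "0 < 1 - y \<bullet> y"
        using y norm1 by simp
      have "ln (1 - y \<bullet> y) < ln (exp (2 * K))"
        using False ypos by (subst ln_less_cancel_iff) (auto simp: S_def)
      then have ly: "ln (1 - y \<bullet> y) < 2 * K"
        by simp
      have "(n - 2) / 2 * ln (1 - y \<bullet> y) \<le> 1 / 2 * ln (1 - y \<bullet> y)"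
        using n ly K by (intro mult_right_mono_neg) auto
      with ly have "0 \<le> K - (n - 2) / 2 * ln (1 - y \<bullet> y)"
        by linarith
      also have "\<dots> \<le> f y"
        using low y by blast
      finally have "f 0 \<le> f y"
        by (simp add: f_def)
      with min[OF 0] show ?thesis
        by linarith
    qed (use min in blast)
  qed
qed

section \<open>The critical point equation and existence of a balancing transformation\<close>

text \<open>The gradient of the horosphere distance sum vanishes at its minimum. The resulting
  equation says that \<open>x\<close> is the barycenter of the \<open>v j\<close> with weights
  \<open>1 / (1 - x \<bullet> v j)\<close>.\<close>

lemma conformal_barycenter_exists:
  fixes v :: "'i \<Rightarrow> 'a::euclidean_space"
  assumes fin: "finite J" and inj: "inj_on v J" and card: "card J \<ge> 3"
    and unit: "\<And>j. j \<in> J \<Longrightarrow> norm (v j) = 1"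
  obtains x where "norm x < 1" and "(\<Sum>j\<in>J. (v j - x) /\<^sub>R (1 - x \<bullet> v j)) = 0"
proof -
  define n where "n = real (card J)"
  define f where "f x = (\<Sum>j\<in>J. ln (1 - x \<bullet> v j)) - n / 2 * ln (1 - x \<bullet> x)" for x
  obtain x where x: "norm x < 1" and min: "\<And>y. norm y < 1 \<Longrightarrow> f x \<le> f y"
    unfolding f_def n_def using horosphere_distance_sum_minimum[OF fin inj card unit] by blast
  have pos: "0 < 1 - x \<bullet> v j" if "j \<in> J" for j
    using one_minus_inner_pos(2)[OF x unit[OF that]] .
  have xx: "0 < 1 - x \<bullet> x"
    using x by (simp add: dot_square_norm abs_square_less_1)
  \<comment> \<open>The gradient of \<open>f\<close> at \<open>x\<close>.\<close>
  define g where "g = (n / (1 - x \<bullet> x)) *\<^sub>R x - (\<Sum>j\<in>J. v j /\<^sub>R (1 - x \<bullet> v j))"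
  have ln_der: "((\<lambda>x. ln (1 - x \<bullet> u x)) has_derivative (\<lambda>h. inverse (1 - x \<bullet> u x) * D h)) (at x)"
    if "((\<lambda>x. 1 - x \<bullet> u x) has_derivative D) (at x)" and "0 < 1 - x \<bullet> u x" for u D
    using has_derivative_ln[OF that(2,1)] by (simp add: mult.commute)
  have "((\<lambda>x. ln (1 - x \<bullet> v j)) has_derivative (\<lambda>h. inverse (1 - x \<bullet> v j) * (0 - h \<bullet> v j))) (at x)"
    if "j \<in> J" for j
    using pos[OF that] by (intro ln_der has_derivative_diff has_derivative_const
        has_derivative_inner_left has_derivative_ident)
  moreover have "((\<lambda>x. ln (1 - x \<bullet> x)) has_derivative
      (\<lambda>h. inverse (1 - x \<bullet> x) * (0 - (x \<bullet> h + h \<bullet> x)))) (at x)"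
    using xx by (intro ln_der has_derivative_diff has_derivative_const has_derivative_inner
        has_derivative_ident)
  ultimately have "(f has_derivative (\<lambda>h. (\<Sum>j\<in>J. inverse (1 - x \<bullet> v j) * (0 - h \<bullet> v j))
      - n / 2 * (inverse (1 - x \<bullet> x) * (0 - (x \<bullet> h + h \<bullet> x))))) (at x)"
    unfolding f_def by (intro has_derivative_diff has_derivative_sum has_derivative_mult_right)
  moreover have "(\<Sum>j\<in>J. inverse (1 - x \<bullet> v j) * (0 - h \<bullet> v j))
      - n / 2 * (inverse (1 - x \<bullet> x) * (0 - (x \<bullet> h + h \<bullet> x))) = h \<bullet> g" for h
  proof -
    have "(\<Sum>j\<in>J. inverse (1 - x \<bullet> v j) * (0 - h \<bullet> v j)) = - (h \<bullet> (\<Sum>j\<in>J. v j /\<^sub>R (1 - x \<bullet> v j)))"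
      by (simp add: inner_sum_right sum_negf)
    moreover have "n / 2 * (inverse (1 - x \<bullet> x) * (0 - (x \<bullet> h + h \<bullet> x))) = - (h \<bullet> (n / (1 - x \<bullet> x)) *\<^sub>R x)"
      unfolding inner_commute[of x h] inner_scaleR_right divide_inverse by algebra
    ultimately show ?thesis
      unfolding g_def inner_diff_right by linarith
  qed
  ultimately have der: "(f has_derivative (\<lambda>h. h \<bullet> g)) (at x)"
    by simp
  have "(\<lambda>h. h \<bullet> g) = (\<lambda>h. 0)"
    by (rule differential_zero_maxmin[OF _ open_ball der, of 0 1]) (use x min in auto)
  then have "g \<bullet> g = 0"
    by metis
  then have g: "(\<Sum>j\<in>J. v j /\<^sub>R (1 - x \<bullet> v j)) = (n / (1 - x \<bullet> x)) *\<^sub>R x"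
    by (simp add: g_def)
  \<comment> \<open>The total weight is found by pairing the gradient equation with
    \<open>x\<close>; it turns the right-hand side of that equation into
    \<open>m *\<^sub>R x\<close>.\<close>
  define m where "m = (\<Sum>j\<in>J. inverse (1 - x \<bullet> v j))"
  have "m - n = (\<Sum>j\<in>J. inverse (1 - x \<bullet> v j) - 1)"
    by (simp add: m_def n_def sum_subtractf)
  also have "\<dots> = (\<Sum>j\<in>J. x \<bullet> (v j /\<^sub>R (1 - x \<bullet> v j)))"
    using pos by (intro sum.cong refl) (force simp: field_simps)
  also have "\<dots> = x \<bullet> ((n / (1 - x \<bullet> x)) *\<^sub>R x)"
    by (simp only: g[symmetric] inner_sum_right)
  also have "\<dots> = n / (1 - x \<bullet> x) - n"
    using xx by (simp add: field_simps)
  finally have m: "m = n / (1 - x \<bullet> x)"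
    by simp
  have "(\<Sum>j\<in>J. (v j - x) /\<^sub>R (1 - x \<bullet> v j)) = (\<Sum>j\<in>J. v j /\<^sub>R (1 - x \<bullet> v j)) - m *\<^sub>R x"
    by (simp add: m_def scaleR_sum_left scaleR_diff_right sum_subtractf)
  with g m have "(\<Sum>j\<in>J. (v j - x) /\<^sub>R (1 - x \<bullet> v j)) = 0"
    by simp
  with x show ?thesis
    by (rule that)
qed

text \<open>A Lorentz map taking the point of the hyperboloid over the conformal barycenter
  \<open>x\<close> to \<open>(1, 0)\<close> divides by \<open>1 - x \<bullet> v j\<close>, up to a
  constant, when \<open>(1, v j)\<close> is renormalized. Linearity then turns the barycenter
  equation into the balancing condition.\<close>

lemma moebius_balancing_exists:
  fixes v :: "'i \<Rightarrow> real ^ 'n"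
  assumes fin: "finite J" and inj: "inj_on v J" and card: "card J \<ge> 3"
    and unit: "\<And>j. j \<in> J \<Longrightarrow> norm (v j) = 1"
  shows "\<exists>T. moebius T \<and> (\<Sum>j\<in>J. T (v j)) = 0"
proof -
  obtain x where x: "norm x < 1" and bal: "(\<Sum>j\<in>J. (v j - x) /\<^sub>R (1 - x \<bullet> v j)) = 0"
    using conformal_barycenter_exists[OF fin inj card unit] by blast
  have xx: "0 < 1 - x \<bullet> x"
    using x by (simp add: dot_square_norm abs_square_less_1)
  \<comment> \<open>This factor scales \<open>(1, x)\<close> onto the hyperboloid.\<close>
  define a where "a = 1 / sqrt (1 - x \<bullet> x)"
  have a: "a > 0" "a * a * (1 - x \<bullet> x) = 1"
    using xx by (simp_all add: a_def)
  define p where "p = (a, a *\<^sub>R x)"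
  have "lorentz_form p = -1"
    using a(2) by (simp add: p_def lorentz_form_eq_inner lorentz_inner_def algebra_simps)
  then obtain A where A: "A \<in> lorentz_group" and Ap: "A p = (1, 0)"
    and fstA: "\<And>u. fst (A u) = - lorentz_inner u p"
    using lorentz_group_exchange[of p] a(1) by (auto simp: p_def)
  have lin: "linear A"
    using A by (simp add: lorentz_group_def)
  have fstA1: "fst (A (1, y)) = a * (1 - x \<bullet> y)" for y
    by (simp add: fstA p_def lorentz_inner_def inner_commute algebra_simps)
  define T where "T y = snd (A (1, y)) /\<^sub>R fst (A (1, y))" for y
  have "moebius T"
    unfolding T_def using one_minus_inner_pos(2)[OF x] a(1)
    by (intro moebiusI[OF A]) (force simp: fstA1)
  moreover have "(\<Sum>j\<in>J. T (v j)) = 0"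
  proof -
    have "A (1, x) = inverse a *\<^sub>R A p"
      using a(1) by (simp add: linear_scale[OF lin, symmetric] p_def)
    then have Ax: "snd (A (1, x)) = 0"
      by (simp add: Ap)
    \<comment> \<open>Since \<open>A (1, x)\<close> is a multiple of \<open>(1, 0)\<close>,
      subtracting \<open>(1, x)\<close> from \<open>(1, v j)\<close> does not change the last
      coordinates of the image.\<close>
    have "T (v j) = snd (A (0, (v j - x) /\<^sub>R (1 - x \<bullet> v j))) /\<^sub>R a" for j
    proof -
      have "(1 :: real, v j) = (0, v j - x) + (1, x)"
        by simp
      then have "snd (A (1, v j)) = snd (A (0, v j - x))"
        using Ax by (metis linear_add[OF lin] snd_add add.right_neutral)
      moreover have "(0 :: real, (v j - x) /\<^sub>R (1 - x \<bullet> v j)) = (0, v j - x) /\<^sub>R (1 - x \<bullet> v j)"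
        by simp
      ultimately show ?thesis
        by (simp add: T_def fstA1 linear_scale[OF lin] del: scaleR_Pair)
    qed
    then have "(\<Sum>j\<in>J. T (v j)) = snd (A (\<Sum>j\<in>J. (0, (v j - x) /\<^sub>R (1 - x \<bullet> v j)))) /\<^sub>R a"
      by (simp add: linear_sum[OF lin] snd_sum scaleR_sum_right)
    also have "(\<Sum>j\<in>J. (0 :: real, (v j - x) /\<^sub>R (1 - x \<bullet> v j))) = 0"
      using bal by (simp add: prod_eq_iff fst_sum snd_sum)
    finally show ?thesis
      by (simp add: linear_0[OF lin])
  qed
  ultimately show ?thesis
    by blast
qed

section \<open>Uniqueness up to isometries\<close>

text \<open>Balance of the \<open>w j\<close> determines the sum of the \<open>c j\<close>, balance
  of the \<open>z j\<close> that of their inverses. Together they force equality in Cauchy-Schwarz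
  between each \<open>w j\<close> and \<open>snd q\<close>; for nonzero \<open>snd q\<close> this
  leaves room for at most two points.\<close>

lemma balanced_lorentz_fixes_origin:
  fixes w z :: "'i \<Rightarrow> real ^ 'n"
  assumes B: "B \<in> lorentz_group" and Bq: "B q = (1, 0)" and q0: "fst q > 0"
    and fin: "finite J" and card: "card J \<ge> 3" and inj: "inj_on w J"
    and unit: "\<And>j. j \<in> J \<Longrightarrow> norm (w j) = 1"
    and Bw: "\<And>j. j \<in> J \<Longrightarrow> B (1, w j) = (c j, c j *\<^sub>R z j)"
    and w0: "(\<Sum>j\<in>J. w j) = 0" and z0: "(\<Sum>j\<in>J. z j) = 0"
  shows "q = (1, 0)"
proof -
  define s y where "s = fst q" and "y = snd q"
  define n where "n = real (card J)"
  have lin: "linear B"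
    using B by (simp add: lorentz_group_def)
  have "lorentz_inner (B q) (B q) = -1"
    unfolding Bq by (simp add: lorentz_inner_def)
  then have qq: "s * s = 1 + y \<bullet> y"
    by (simp add: lorentz_group_inner[OF B]) (simp add: lorentz_inner_def s_def y_def)
  have s: "s > 0"
    using q0 by (simp add: s_def)
  \<comment> \<open>Pair \<open>(1, w j)\<close> with \<open>q\<close> and use invariance under
    \<open>B\<close>.\<close>
  have c: "c j = s - w j \<bullet> y" if "j \<in> J" for j
  proof -
    have "lorentz_inner (B (1, w j)) (B q) = - c j"
      unfolding Bq Bw[OF that] by (simp add: lorentz_inner_def)
    then show ?thesis
      by (simp add: lorentz_group_inner[OF B]) (simp add: lorentz_inner_def s_def y_def)
  qed
  have le: "(w j \<bullet> y)\<^sup>2 \<le> y \<bullet> y" if "j \<in> J" for j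
    using Cauchy_Schwarz_ineq[of "w j" y] unit[OF that] by (simp add: dot_square_norm)
  have cpos: "c j > 0" if "j \<in> J" for j
  proof -
    have "(w j \<bullet> y)\<^sup>2 < s\<^sup>2"
      using le[OF that] qq by (simp add: power2_eq_square)
    then have "w j \<bullet> y < s"
      using s by (simp add: power_less_imp_less_base)
    then show ?thesis
      using c that by simp
  qed
  have sum_c: "(\<Sum>j\<in>J. c j) = n * s"
  proof -
    have "(\<Sum>j\<in>J. c j) = (\<Sum>j\<in>J. s - w j \<bullet> y)"
      using c by simp
    also have "\<dots> = n * s - (\<Sum>j\<in>J. w j) \<bullet> y"
      by (simp add: sum_subtractf n_def inner_sum_left)
    finally show ?thesis
      by (simp add: w0)
  qed
  \<comment> \<open>The vectors \<open>(1, w j) /\<^sub>R c j\<close> are sent to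
    \<open>(1, z j)\<close>, whose sum is \<open>n\<close> times \<open>B q\<close>. Injectivity of
    \<open>B\<close> and comparison of first coordinates give the claim.\<close>
  have sum_inv: "(\<Sum>j\<in>J. 1 / c j) = n * s"
  proof -
    have "B (\<Sum>j\<in>J. (1, w j) /\<^sub>R c j) = (\<Sum>j\<in>J. B (1, w j) /\<^sub>R c j)"
      by (simp add: linear_sum[OF lin] linear_scale[OF lin] del: scaleR_Pair)
    also have "\<dots> = (\<Sum>j\<in>J. (1, z j))"
      using Bw cpos by (intro sum.cong refl) force
    also have "\<dots> = n *\<^sub>R B q"
      using z0 by (simp add: Bq n_def prod_eq_iff fst_sum snd_sum)
    also have "\<dots> = B (n *\<^sub>R q)"
      by (simp add: linear_scale[OF lin])
    finally have "(\<Sum>j\<in>J. (1, w j) /\<^sub>R c j) = n *\<^sub>R q"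
      using B by (simp add: lorentz_group_def bij_def inj_eq)
    then show ?thesis
      by (simp add: prod_eq_iff fst_sum s_def divide_inverse)
  qed
  txt \<open>This is the difference of the derivatives of the strictly convex function above at the
    two ends of the geodesic from \<open>(1, 0)\<close> to \<open>q\<close>, both of which vanish.\<close>
  have "(\<Sum>j\<in>J. (y \<bullet> y - (w j \<bullet> y)\<^sup>2) / c j)
      = (\<Sum>j\<in>J. (y \<bullet> y - s\<^sup>2) * (1 / c j) + 2 * s - c j)"
    using c cpos by (intro sum.cong refl) (force simp: field_simps power2_eq_square)
  also have "\<dots> = (y \<bullet> y - s\<^sup>2) * (n * s) + n * (2 * s) - n * s"
    by (simp add: sum.distrib sum_subtractf sum_distrib_left[symmetric] sum_inv sum_c n_def
        del: times_divide_eq_right)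
  also have "\<dots> = 0"
    using qq by (simp add: power2_eq_square algebra_simps)
  \<comment> \<open>Each summand is nonnegative by \<open>le\<close> and \<open>cpos\<close>, so a
    zero sum makes each vanish.\<close>
  finally have "\<forall>j\<in>J. (y \<bullet> y - (w j \<bullet> y)\<^sup>2) / c j = 0"
    using fin le cpos by (subst (asm) sum_nonneg_eq_0_iff) (auto intro!: divide_nonneg_pos)
  then have eq: "(w j \<bullet> y)\<^sup>2 = y \<bullet> y" if "j \<in> J" for j
    using that cpos by force
  have "y = 0"
  proof (rule ccontr)
    assume y: "y \<noteq> 0"
    have "w j \<in> {y /\<^sub>R norm y, - (y /\<^sub>R norm y)}" if j: "j \<in> J" for j
    proof -
      have "sqrt ((w j \<bullet> y)\<^sup>2) = sqrt (y \<bullet> y)"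
        using eq[OF j] by simp
      then have "\<bar>w j \<bullet> y\<bar> = norm (w j) * norm y"
        using unit[OF j] by (simp add: norm_eq_sqrt_inner)
      then have "norm (w j) *\<^sub>R y = norm y *\<^sub>R w j \<or> norm (w j) *\<^sub>R y = - norm y *\<^sub>R w j"
        by (simp add: norm_cauchy_schwarz_abs_eq)
      then have "y = norm y *\<^sub>R w j \<or> y = norm y *\<^sub>R (- w j)"
        using unit[OF j] by simp
      then have "w j = y /\<^sub>R norm y \<or> - w j = y /\<^sub>R norm y"
        using y by (metis divideR_right norm_eq_zero)
      then show ?thesis
        by (metis insertI1 insertI2 minus_minus)
    qed
    then have "w ` J \<subseteq> {y /\<^sub>R norm y, - (y /\<^sub>R norm y)}"
      by blast
    then have "card (w ` J) \<le> card {y /\<^sub>R norm y, - (y /\<^sub>R norm y)}"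
      by (intro card_mono) auto
    also have "\<dots> \<le> 2"
      by (simp add: card_insert_if)
    finally show False
      using card by (simp add: card_image[OF inj])
  qed
  then have "s = 1"
    using qq s by (simp add: square_eq_1_iff)
  with \<open>y = 0\<close> show ?thesis
    by (simp add: s_def y_def prod_eq_iff)
qed

text \<open>Such a map preserves the Lorentz complement of \<open>(1, 0)\<close>, which is the set
  of all \<open>(0, y)\<close>; there the form is the squared Euclidean norm.\<close>

lemma lorentz_fixing_origin_orthogonal:
  assumes B: "B \<in> lorentz_group" and e: "B (1, 0) = (1, 0)"
  obtains R where "orthogonal_transformation R" and "\<And>y. B (1, y) = (1, R y)"
proof -
  have lin: "linear B"
    using B by (simp add: lorentz_group_def)
  define R where "R y = snd (B (0, y))" for y
  have "fst (B (0, y)) = 0" for y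
    using lorentz_group_inner[OF B, of "(0, y)" "(1, 0)"] by (simp add: e) (simp add: lorentz_inner_def)
  then have BR: "B (0, y) = (0, R y)" for y
    by (simp add: R_def prod_eq_iff)
  have "linear (\<lambda>y. (0 :: real, y :: real ^ 'n))"
    by (rule linearI) auto
  then have "linear R"
    unfolding R_def using lin by (intro linear_compose[unfolded o_def, OF _ linear_snd]) (rule linear_compose[unfolded o_def])
  moreover have "norm (R y) = norm y" for y
  proof -
    have "lorentz_inner (B (0, y)) (B (0, y)) = lorentz_inner (0, y) (0, y)"
      by (rule lorentz_group_inner[OF B])
    then show ?thesis
      by (simp add: BR) (simp add: lorentz_inner_def norm_eq)
  qed
  ultimately have "orthogonal_transformation R"
    by (simp add: orthogonal_transformation)
  moreover have "B (1, y) = (1, R y)" for y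
    using linear_add[OF lin, of "(1, 0)" "(0, y)"] by (simp add: e BR)
  ultimately show ?thesis
    by (rule that)
qed

text \<open>The transition map \<open>A' \<circ> inv A\<close> carries the balanced points
  \<open>T (v j)\<close>, still distinct by injectivity of \<open>T\<close>, to the balanced points
  \<open>T' (v j)\<close>. Up to sign it therefore fixes \<open>(1, 0)\<close> and is orthogonal on
  the last coordinates.\<close>

lemma moebius_balancing_unique:
  fixes v :: "'i \<Rightarrow> real ^ 'n"
  assumes fin: "finite J" and inj: "inj_on v J" and card: "card J \<ge> 3"
    and unit: "\<And>j. j \<in> J \<Longrightarrow> norm (v j) = 1"
    and T: "moebius T" and T0: "(\<Sum>j\<in>J. T (v j)) = 0"
    and T': "moebius T'" and T'0: "(\<Sum>j\<in>J. T' (v j)) = 0"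
  shows "\<exists>R. orthogonal_transformation R \<and> (\<forall>y\<in>sphere 0 1. T' y = R (T y))"
proof -
  obtain A c where A: "A \<in> lorentz_group"
    and TS: "\<And>y. y \<in> sphere 0 1 \<Longrightarrow> T y \<in> sphere 0 1"
    and c: "\<And>y. y \<in> sphere 0 1 \<Longrightarrow> c y \<noteq> 0"
    and Ac: "\<And>y. y \<in> sphere 0 1 \<Longrightarrow> A (1, y) = (c y, c y *\<^sub>R T y)"
    using moebius_obtain[OF T] by metis
  obtain A' c' where A': "A' \<in> lorentz_group"
    and c': "\<And>y. y \<in> sphere 0 1 \<Longrightarrow> c' y \<noteq> 0"
    and Ac': "\<And>y. y \<in> sphere 0 1 \<Longrightarrow> A' (1, y) = (c' y, c' y *\<^sub>R T' y)"
    using moebius_obtain[OF T'] by metis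
  have linA: "linear A" and injA: "inj A" and linA': "linear A'"
    using A A' by (auto simp: lorentz_group_def bij_def)
  have ATy: "(1, T y) = A ((1, y) /\<^sub>R c y)" if "y \<in> sphere 0 1" for y
    using c[OF that] Ac[OF that] by (simp add: linear_scale[OF linA] del: scaleR_Pair) simp
  have injT: "inj_on T (sphere 0 1)"
  proof (rule inj_onI)
    fix y y'
    assume y: "y \<in> sphere 0 1" "y' \<in> sphere 0 1" and "T y = T y'"
    then have "A ((1, y) /\<^sub>R c y) = A ((1, y') /\<^sub>R c y')"
      using ATy by metis
    then have "(1 :: real, y) /\<^sub>R c y = (1, y') /\<^sub>R c y'"
      using injA by (simp only: inj_eq)
    then have "c y = c y'" and "y /\<^sub>R c y = y' /\<^sub>R c y'"
      by auto
    then show "y = y'"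
      using c[OF y(1)] by simp
  qed
  have vS: "v j \<in> sphere 0 1" if "j \<in> J" for j
    using unit that by simp
  have injTv: "inj_on (\<lambda>j. T (v j)) J"
    using inj injT vS by (auto simp: inj_on_def)
  define B where "B = A' \<circ> inv A"
  have B: "B \<in> lorentz_group"
    unfolding B_def using A A' by (rule lorentz_group_compose_inv)
  have BT: "B (1, T y) = (c' y / c y, (c' y / c y) *\<^sub>R T' y)" if "y \<in> sphere 0 1" for y
    using Ac'[OF that] injA
    by (simp add: B_def ATy[OF that] linear_scale[OF linA'] divide_inverse mult.commute del: scaleR_Pair) simp
  \<comment> \<open>Passing from \<open>B\<close> to \<open>- B\<close> if necessary puts the
    preimage of \<open>(1, 0)\<close> on the upper sheet of the hyperboloid.\<close>
  have "\<exists>B' k. B' \<in> lorentz_group \<and> (\<exists>q. B' q = (1, 0) \<and> fst q > 0) \<and>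
      (\<forall>y\<in>sphere 0 1. B' (1, T y) = (k y, k y *\<^sub>R T' y))"
  proof -
    obtain q where q: "B q = (1, 0)"
      using B by (metis (mono_tags, lifting) bij_pointE lorentz_group_def mem_Collect_eq)
    have "lorentz_inner (B q) (B q) = -1"
      unfolding q by (simp add: lorentz_inner_def)
    then have "snd q \<bullet> snd q - fst q * fst q = -1"
      by (simp add: lorentz_group_inner[OF B]) (simp add: lorentz_inner_def)
    then have "fst q \<noteq> 0"
      by (metis diff_zero inner_ge_zero mult_zero_left neg_0_le_iff_le not_one_le_zero)
    then consider "fst q > 0" | "fst q < 0"
      by linarith
    then show ?thesis
    proof cases
      case 1
      with q B BT show ?thesis
        by (intro exI[of _ B] exI[of _ "\<lambda>y. c' y / c y"]) blast
    next
      case 2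
      have "- B (- q) = (1, 0)"
        using q B by (simp add: lorentz_group_def linear_neg)
      moreover have "\<forall>y\<in>sphere 0 1. - B (1, T y) = (- (c' y / c y), - (c' y / c y) *\<^sub>R T' y)"
        using BT by simp
      moreover have "fst (- q) > 0"
        using 2 by simp
      ultimately show ?thesis
        using lorentz_group_uminus[OF B]
        by (intro exI[of _ "\<lambda>x. - B x"] exI[of _ "\<lambda>y. - (c' y / c y)"]) blast
    qed
  qed
  then obtain B' k q where B': "B' \<in> lorentz_group" and q: "B' q = (1, 0)" "fst q > 0"
    and k: "\<And>y. y \<in> sphere 0 1 \<Longrightarrow> B' (1, T y) = (k y, k y *\<^sub>R T' y)"
    by blast
  have "q = (1, 0)"
    by (rule balanced_lorentz_fixes_origin[OF B' q fin card injTv _ k[OF vS] T0 T'0])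
      (use TS vS in auto)
  with q B' obtain R where R: "orthogonal_transformation R" "\<And>y. B' (1, y) = (1, R y)"
    using lorentz_fixing_origin_orthogonal[OF B'] by blast
  \<comment> \<open>Comparing first coordinates gives \<open>k y = 1\<close>.\<close>
  have "T' y = R (T y)" if "y \<in> sphere 0 1" for y
    using k[OF that] R(2)[of "T y"] by simp
  with R(1) show ?thesis
    by blast
qed

theorem lemma1:
  fixes d n :: nat and v :: "nat \<Rightarrow> real ^ 'n"
  assumes "d \<ge> 1" and "CARD('n) = d + 1"
    and "n \<ge> 3"
    and "\<And>j. j \<in> {1..n} \<Longrightarrow> v j \<in> sphere 0 1"
    and "inj_on v {1..n}"
  shows "(\<exists>T. moebius T \<and> (\<Sum>j=1..n. T (v j)) = 0) \<and>
    (\<forall>T T'. moebius T \<and> (\<Sum>j=1..n. T (v j)) = 0 \<and>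
            moebius T' \<and> (\<Sum>j=1..n. T' (v j)) = 0 \<longrightarrow>
       (\<exists>R. orthogonal_transformation R \<and> (\<forall>y\<in>sphere 0 1. T' y = R (T y))))"
proof -
  have card: "card {1..n} \<ge> 3"
    using assms(3) by simp
  have unit: "norm (v j) = 1" if "j \<in> {1..n}" for j
    using assms(4)[OF that] by simp
  show ?thesis
    using moebius_balancing_exists[OF finite_atLeastAtMost assms(5) card unit]
      moebius_balancing_unique[OF finite_atLeastAtMost assms(5) card unit]
    by blast
qed

end
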